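(* Let $l\ge1$. For $b=(x_1,x_2)\in\tilde{\mathcal B}_{3l}$ define a sequence $(b_1,b_2,\dots,b_l)\in\mathcal B_1^l$ by cutting the one-row tableau $1^{x_1}2^{x_2}$ (of length $3l$) from left to right into $l$ consecutive triples and sending the triples to the corresponding elements of $\mathcal B_1$: $$111\mapsto2,\qquad112\mapsto2_1,\qquad122\mapsto2_2,\qquad222\mapsto3 .$$ Then the map $i_l:\tilde{\mathcal B}_{3l}\to\mathcal B_1^{\otimes l}$ given by $i_l(b)=b_l\otimes b_{l-1}\otimes\cdots\otimes b_1$ (and $i_l(0)=0$) satisfies $$i_l(\tilde e_1^Ab)=\tilde e_2\,i_l(b),\qquad i_l(\tilde f_1^Ab)=\tilde f_2\,i_l(b)$$ for all $b\in\tilde{\mathcal B}_{3l}$.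
   Context: $\tilde{\mathcal B}_m=\{(x_1,x_2)\in\mathbb Z_{\ge0}^2:x_1+x_2=m\}$ is the $U_q'(A_1^{(1)})$-crystal with $\tilde e_1^A(x_1,x_2)=(x_1+1,x_2-1)$ and $\tilde f_1^A(x_1,x_2)=(x_1-1,x_2+1)$, the result being understood as $0$ if a coordinate becomes negative; $(x_1,x_2)$ is identified with the one-row tableau with $x_1$ ones followed by $x_2$ twos. $\mathcal B_1$ is the level-one perfect crystal of $U_q'(G_2^{(1)})$. Only its operators $\tilde e_2,\tilde f_2$ and functions $\varepsilon_2,\varphi_2$ on the four elements $2,2_1,2_2,3$ (in coordinates $(0,1,0,0,0,0)$, $(0,\frac23,\frac23,0,0,0)$, $(0,\frac13,\frac43,0,0,0)$, $(0,0,2,0,0,0)$) are needed; these elements form a complete $2$-string: $\tilde f_2(2)=2_1$, $\tilde f_2(2_1)=2_2$, $\tilde f_2(2_2)=3$, $\tilde f_2(3)=0$; $\tilde e_2(3)=2_2$, $\tilde e_2(2_2)=2_1$, $\tilde e_2(2_1)=2$, $\tilde e_2(2)=0$; $(\varepsilon_2,\varphi_2)=(0,3),(1,2),(2,1),(3,0)$ on $2,2_1,2_2,3$ respectively (here the value $0$ is the zero symbol). Tensor product rule: $\tilde e_2(c_1\otimes c_2)=\tilde e_2c_1\otimes c_2$ if $\varphi_2(c_1)\ge\varepsilon_2(c_2)$ and $c_1\otimes\tilde e_2c_2$ otherwise; $\tilde f_2(c_1\otimes c_2)=\tilde f_2c_1\otimes c_2$ if $\varphi_2(c_1)>\varepsilon_2(c_2)$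 and $c_1\otimes\tilde f_2c_2$ otherwise; $\varepsilon_2(c_1\otimes c_2)=\max(\varepsilon_2(c_1),\varepsilon_2(c_2)-\varphi_2(c_1)+\varepsilon_2(c_1))$, $\varphi_2(c_1\otimes c_2)=\max(\varphi_2(c_2),\varphi_2(c_1)+\varphi_2(c_2)-\varepsilon_2(c_2))$; $c\otimes0=0\otimes c=0$. Multiple tensor products are formed associatively. *)

theory Defs
  imports Complex_Main "HOL-Library.FuncSet"
begin

text \<open>The zero symbol of a crystal is rendered by \<^const>\<open>None\<close>, so that \<open>i(0) = 0\<close> becomes
  \<^const>\<open>map_option\<close> and no crystal element can be confused with it.\<close>

definition tilde_B :: "nat \<Rightarrow> (int \<times> int) set" where
  "tilde_B m = {(x1, x2). 0 \<le> x1 \<and> 0 \<le> x2 \<and> x1 + x2 = int m}"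

definition nonneg_or_zero :: "int \<times> int \<Rightarrow> (int \<times> int) option" where
  "nonneg_or_zero b = (if 0 \<le> fst b \<and> 0 \<le> snd b then Some b else None)"

definition e1A :: "int \<times> int \<Rightarrow> (int \<times> int) option" where
  "e1A b = nonneg_or_zero (fst b + 1, snd b - 1)"

definition f1A :: "int \<times> int \<Rightarrow> (int \<times> int) option" where
  "f1A b = nonneg_or_zero (fst b - 1, snd b + 1)"

definition tableau :: "int \<times> int \<Rightarrow> nat list" where
  "tableau b = replicate (nat (fst b)) 1 @ replicate (nat (snd b)) 2"


record 'b crystal2 =
  carr :: "'b set"
  e2 :: "'b \<Rightarrow> 'b option"
  f2 :: "'b \<Rightarrow> 'b option"
  eps2 :: "'b \<Rightarrow> int"
  phi2 :: "'b \<Rightarrow> int"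

text \<open>The word \<open>[c\<^sub>1, \<dots>, c\<^sub>n]\<close> stands for \<open>c\<^sub>1 \<otimes> \<dots> \<otimes> c\<^sub>n\<close>. The operators below apply the binary tensor
  product rule to \<open>c\<^sub>1 \<otimes> (c\<^sub>2 \<otimes> \<dots> \<otimes> c\<^sub>n)\<close>; independence of the bracketing is the lemma
  \<open>ten_append\<close>. The values at the empty word are irrelevant.\<close>

definition tensor_power :: "('b, 'm) crystal2_scheme \<Rightarrow> nat \<Rightarrow> 'b list set" where
  "tensor_power C l = {w. length w = l \<and> set w \<subseteq> carr C}"

fun ten_eps :: "('b, 'm) crystal2_scheme \<Rightarrow> 'b list \<Rightarrow> int" where
  "ten_eps C [] = 0"
| "ten_eps C [c] = eps2 C c"
| "ten_eps C (c # d # w) =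
     max (eps2 C c) (ten_eps C (d # w) - phi2 C c + eps2 C c)"

fun ten_phi :: "('b, 'm) crystal2_scheme \<Rightarrow> 'b list \<Rightarrow> int" where
  "ten_phi C [] = 0"
| "ten_phi C [c] = phi2 C c"
| "ten_phi C (c # d # w) =
     max (ten_phi C (d # w)) (phi2 C c + ten_phi C (d # w) - ten_eps C (d # w))"

fun ten_e :: "('b, 'm) crystal2_scheme \<Rightarrow> 'b list \<Rightarrow> 'b list option" where
  "ten_e C [] = None"
| "ten_e C [c] = map_option (\<lambda>c'. [c']) (e2 C c)"
| "ten_e C (c # d # w) =
     (if phi2 C c \<ge> ten_eps C (d # w)
      then map_option (\<lambda>c'. c' # d # w) (e2 C c)
      else map_option (\<lambda>w'. c # w') (ten_e C (d # w)))"

fun ten_f :: "('b, 'm) crystal2_scheme \<Rightarrow> 'b list \<Rightarrow> 'b list option" where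
  "ten_f C [] = None"
| "ten_f C [c] = map_option (\<lambda>c'. [c']) (f2 C c)"
| "ten_f C (c # d # w) =
     (if phi2 C c > ten_eps C (d # w)
      then map_option (\<lambda>c'. c' # d # w) (f2 C c)
      else map_option (\<lambda>w'. c # w') (ten_f C (d # w)))"

lemma ten_append:
  assumes "u \<noteq> []" "v \<noteq> []"
  shows "ten_eps C (u @ v) = max (ten_eps C u) (ten_eps C v - ten_phi C u + ten_eps C u)"
    and "ten_phi C (u @ v) = max (ten_phi C v) (ten_phi C u + ten_phi C v - ten_eps C v)"
    and "ten_e C (u @ v) = (if ten_phi C u \<ge> ten_eps C v
           then map_option (\<lambda>u'. u' @ v) (ten_e C u) else map_option (\<lambda>v'. u @ v') (ten_e C v))"
    and "ten_f C (u @ v) = (if ten_phi C u > ten_eps C v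
           then map_option (\<lambda>u'. u' @ v) (ten_f C u) else map_option (\<lambda>v'. u @ v') (ten_f C v))"
proof -
  obtain d w where v: "v = d # w" using assms(2) by (cases v) auto
  have "ten_eps C (u @ v) = max (ten_eps C u) (ten_eps C v - ten_phi C u + ten_eps C u) \<and>
    ten_phi C (u @ v) = max (ten_phi C v) (ten_phi C u + ten_phi C v - ten_eps C v) \<and>
    ten_e C (u @ v) = (if ten_phi C u \<ge> ten_eps C v
       then map_option (\<lambda>u'. u' @ v) (ten_e C u) else map_option (\<lambda>v'. u @ v') (ten_e C v)) \<and>
    ten_f C (u @ v) = (if ten_phi C u > ten_eps C v
       then map_option (\<lambda>u'. u' @ v) (ten_f C u) else map_option (\<lambda>v'. u @ v') (ten_f C v))"
    using assms(1)
  proof (induction u rule: list_nonempty_induct)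
    case (single x)
    have "(@) [x] = (#) x" by auto
    then show ?case by (simp add: v option.map_comp o_def)
  next
    case (cons x xs)
    obtain y ys where xs: "xs = y # ys" using cons by (cases xs) auto
    have ne: "ten_eps C (x # xs @ v) = max (eps2 C x) (ten_eps C (xs @ v) - phi2 C x + eps2 C x)"
      "ten_phi C (x # xs @ v) =
         max (ten_phi C (xs @ v)) (phi2 C x + ten_phi C (xs @ v) - ten_eps C (xs @ v))"
      "ten_e C (x # xs @ v) = (if phi2 C x \<ge> ten_eps C (xs @ v)
         then map_option (\<lambda>c'. c' # xs @ v) (e2 C x)
         else map_option (\<lambda>w'. x # w') (ten_e C (xs @ v)))"
      "ten_f C (x # xs @ v) = (if phi2 C x > ten_eps C (xs @ v)
         then map_option (\<lambda>c'. c' # xs @ v) (f2 C x)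
         else map_option (\<lambda>w'. x # w') (ten_f C (xs @ v)))"
      by (simp_all add: xs)
    have ne': "ten_eps C (x # xs) = max (eps2 C x) (ten_eps C xs - phi2 C x + eps2 C x)"
      "ten_phi C (x # xs) = max (ten_phi C xs) (phi2 C x + ten_phi C xs - ten_eps C xs)"
      "ten_e C (x # xs) = (if phi2 C x \<ge> ten_eps C xs
         then map_option (\<lambda>c'. c' # xs) (e2 C x) else map_option (\<lambda>w'. x # w') (ten_e C xs))"
      "ten_f C (x # xs) = (if phi2 C x > ten_eps C xs
         then map_option (\<lambda>c'. c' # xs) (f2 C x) else map_option (\<lambda>w'. x # w') (ten_f C xs))"
      by (simp_all add: xs)
    have "(@) (x # xs) = (\<lambda>w. x # xs @ w)" by auto
    then show ?case using cons.IH
      by (auto simp: ne ne' max_def option.map_comp o_def split: if_splits)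
  qed
  then show "ten_eps C (u @ v) = max (ten_eps C u) (ten_eps C v - ten_phi C u + ten_eps C u)"
    and "ten_phi C (u @ v) = max (ten_phi C v) (ten_phi C u + ten_phi C v - ten_eps C v)"
    and "ten_e C (u @ v) = (if ten_phi C u \<ge> ten_eps C v
           then map_option (\<lambda>u'. u' @ v) (ten_e C u) else map_option (\<lambda>v'. u @ v') (ten_e C v))"
    and "ten_f C (u @ v) = (if ten_phi C u > ten_eps C v
           then map_option (\<lambda>u'. u' @ v) (ten_f C u) else map_option (\<lambda>v'. u @ v') (ten_f C v))"
    by blast+
qed


text \<open>\<open>q2\<close>, \<open>q2_1\<close>, \<open>q2_2\<close>, \<open>q3\<close> are the elements \<open>2\<close>, \<open>2\<^sub>1\<close>, \<open>2\<^sub>2\<close>, \<open>3\<close> of the level-one perfect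
  crystal of type \<open>G\<^sub>2\<^sup>(\<^sup>1\<^sup>)\<close>.\<close>

type_synonym coords = "rat \<times> rat \<times> rat \<times> rat \<times> rat \<times> rat"

definition q2 :: coords where "q2 = (0, 1, 0, 0, 0, 0)"
definition q2_1 :: coords where "q2_1 = (0, 2/3, 2/3, 0, 0, 0)"
definition q2_2 :: coords where "q2_2 = (0, 1/3, 4/3, 0, 0, 0)"
definition q3 :: coords where "q3 = (0, 0, 2, 0, 0, 0)"

text \<open>The 2-crystal structure of the level-one perfect crystal is prescribed on the complete
  2-string through these four elements and left arbitrary on all other elements.\<close>

definition is_B1 :: "coords crystal2 \<Rightarrow> bool" where
  "is_B1 C \<longleftrightarrow>
     {q2, q2_1, q2_2, q3} \<subseteq> carr C \<and>
     f2 C q2 = Some q2_1 \<and> f2 C q2_1 = Some q2_2 \<and> f2 C q2_2 = Some q3 \<and> f2 C q3 = None \<and>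
     e2 C q3 = Some q2_2 \<and> e2 C q2_2 = Some q2_1 \<and> e2 C q2_1 = Some q2 \<and> e2 C q2 = None \<and>
     (eps2 C q2, phi2 C q2) = (0, 3) \<and> (eps2 C q2_1, phi2 C q2_1) = (1, 2) \<and>
     (eps2 C q2_2, phi2 C q2_2) = (2, 1) \<and> (eps2 C q3, phi2 C q3) = (3, 0)"

lemma is_B1_satisfiable: "\<exists>C. is_B1 C"
proof
  show "is_B1 \<lparr>carr = {q2, q2_1, q2_2, q3},
    e2 = (\<lambda>c. if c = q3 then Some q2_2 else if c = q2_2 then Some q2_1
              else if c = q2_1 then Some q2 else None),
    f2 = (\<lambda>c. if c = q2 then Some q2_1 else if c = q2_1 then Some q2_2
              else if c = q2_2 then Some q3 else None),
    eps2 = (\<lambda>c. if c = q2 then 0 else if c = q2_1 then 1 else if c = q2_2 then 2 else 3),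
    phi2 = (\<lambda>c. if c = q2 then 3 else if c = q2_1 then 2 else if c = q2_2 then 1 else 0)\<rparr>"
    by (simp add: is_B1_def q2_def q2_1_def q2_2_def q3_def)
qed


definition triple_elt :: "nat list \<Rightarrow> coords" where
  "triple_elt t =
     (if t = [1, 1, 1] then q2
      else if t = [1, 1, 2] then q2_1
      else if t = [1, 2, 2] then q2_2
      else if t = [2, 2, 2] then q3
      else undefined)"

text \<open>\<open>b\<^sub>k\<close> for \<open>k = 1, \<dots>, l\<close>, the image of the \<open>k\<close>-th triple from the left.\<close>

definition b_seq :: "int \<times> int \<Rightarrow> nat \<Rightarrow> coords" where
  "b_seq b k = triple_elt (take 3 (drop (3 * (k - 1)) (tableau b)))"

definition i_map :: "nat \<Rightarrow> int \<times> int \<Rightarrow> coords list" where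
  "i_map l b = map (b_seq b) (rev [1..<Suc l])"

end

theory Submission
  imports Defs
begin

text \<open>Tensor words are built from the left, so peeling the leftmost factor \<open>b\<^sub>l\<close> amounts to cutting
  off the last triple of the tableau: if that triple contains \<open>j = min x\<^sub>2 3\<close> twos, the remaining
  word is the image of a tableau with \<open>x\<^sub>2 - j\<close> twos. Induction on \<open>l\<close> gives
  \<open>\<epsilon>\<^sub>2(i\<^sub>l(b)) = x\<^sub>2\<close>. If \<open>x\<^sub>2 > 3\<close>, the leftmost factor is \<open>3\<close> with \<open>\<phi>\<^sub>2 = 0 < \<epsilon>\<^sub>2\<close> of the rest, so both
  operators pass to the rest; if \<open>x\<^sub>2 < 3\<close>, the rest has \<open>\<epsilon>\<^sub>2 = 0 < \<phi>\<^sub>2\<close> and both act on the leftmost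
  factor; at \<open>x\<^sub>2 = 3\<close> the operator \<open>e\<^sub>2\<close> acts on the leftmost factor and \<open>f\<^sub>2\<close> on the rest.\<close>

text \<open>The index is the number of twos in a triple, which is also \<open>eps2\<close>. Clamping
  outside 0..3 makes the function total with values in the string.\<close>

definition string_elt :: "int \<Rightarrow> coords" where
  "string_elt j = (if j \<le> 0 then q2 else if j = 1 then q2_1 else if j = 2 then q2_2 else q3)"

lemma string_elt_carr:
  assumes "is_B1 C"
  shows "string_elt j \<in> carr C"
  using assms by (auto simp: is_B1_def string_elt_def)

lemma string_elt_structure:
  assumes "is_B1 C" "0 \<le> j" "j \<le> 3"
  shows "eps2 C (string_elt j) = j"
    and "phi2 C (string_elt j) = 3 - j"
    and "e2 C (string_elt j) = (if j = 0 then None else Some (string_elt (j - 1)))"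
    and "f2 C (string_elt j) = (if j = 3 then None else Some (string_elt (j + 1)))"
proof -
  from assms(2,3) consider "j = 0" | "j = 1" | "j = 2" | "j = 3" by linarith
  then show "eps2 C (string_elt j) = j"
    and "phi2 C (string_elt j) = 3 - j"
    and "e2 C (string_elt j) = (if j = 0 then None else Some (string_elt (j - 1)))"
    and "f2 C (string_elt j) = (if j = 3 then None else Some (string_elt (j + 1)))"
    using assms(1) by (cases; simp add: is_B1_def string_elt_def)+
qed

text \<open>On complete string elements the tensor rules also hold when the right factor is the empty
  word, with \<open>\<epsilon>\<^sub>2 = 0\<close>.\<close>

lemma ten_Cons_string_elt:
  assumes "is_B1 C" "0 \<le> j" "j \<le> 3" "0 \<le> ten_eps C w"
  shows "ten_eps C (string_elt j # w) = max j (ten_eps C w - 3 + 2 * j)"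
    and "ten_e C (string_elt j # w) =
      (if 3 - j \<ge> ten_eps C w
       then if j = 0 then None else Some (string_elt (j - 1) # w)
       else map_option ((#) (string_elt j)) (ten_e C w))"
    and "ten_f C (string_elt j # w) =
      (if 3 - j > ten_eps C w then Some (string_elt (j + 1) # w)
       else map_option ((#) (string_elt j)) (ten_f C w))"
proof -
  note string = string_elt_structure[OF assms(1-3)]
  show "ten_eps C (string_elt j # w) = max j (ten_eps C w - 3 + 2 * j)"
    using assms(2,3) by (cases w) (simp_all add: string)
  show "ten_e C (string_elt j # w) =
      (if 3 - j \<ge> ten_eps C w
       then if j = 0 then None else Some (string_elt (j - 1) # w)
       else map_option ((#) (string_elt j)) (ten_e C w))"
    using assms(2,3) by (cases w) (simp_all add: string)
  show "ten_f C (string_elt j # w) =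
      (if 3 - j > ten_eps C w then Some (string_elt (j + 1) # w)
       else map_option ((#) (string_elt j)) (ten_f C w))"
    \<comment> \<open>For \<open>j = 3\<close>, where \<open>f2\<close> gives \<open>None\<close>,
      nonnegativity of \<open>ten_eps C w\<close> rules out the \<open>Some\<close> branch.\<close>
    using string assms(2-4) by (cases w; cases "j = 3") simp_all
qed

text \<open>With the number of twos as sole parameter, the operators become shifts of
  \<open>x\<close> by one.\<close>

definition i_word :: "nat \<Rightarrow> int \<Rightarrow> coords list" where
  "i_word l x = i_map l (3 * int l - x, x)"

text \<open>A prefix of a tableau is again a tableau; this identifies what is left after cutting off
  the last triple.\<close>

lemma take_tableau:
  assumes "0 \<le> x1" "0 \<le> x2"
  shows "take n (tableau (x1, x2)) = tableau (min x1 (int n), min x2 (max 0 (int n - x1)))"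
proof -
  have "min n (nat x1) = nat (min x1 (int n))"
    "min (n - nat x1) (nat x2) = nat (min x2 (max 0 (int n - x1)))"
    using assms by linarith+
  then show ?thesis by (simp add: tableau_def)
qed

lemma triple_elt_drop_tableau:
  assumes "0 \<le> x" "x \<le> 3 * int (Suc l)"
  shows "triple_elt (drop (3 * l) (tableau (3 * int (Suc l) - x, x))) = string_elt (min x 3)"
proof -
  from assms(1) consider "x = 0" | "x = 1" | "x = 2" | "3 \<le> x" by linarith
  then show ?thesis
  proof cases
    case 1
    \<comment> \<open>Splitting the block of ones at \<open>3 * l\<close> isolates exactly the
      dropped prefix; likewise in the next two cases.\<close>
    then have "nat (3 * int (Suc l) - x) = 3 * l + 3" by simp
    then have "drop (3 * l) (tableau (3 * int (Suc l) - x, x)) = replicate 3 1 @ replicate 0 2"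
      by (simp only: tableau_def fst_conv snd_conv replicate_add append_assoc) (simp add: 1)
    with 1 show ?thesis
      by (simp add: triple_elt_def string_elt_def numeral_eq_Suc)
  next
    case 2
    then have "nat (3 * int (Suc l) - x) = 3 * l + 2" by simp
    then have "drop (3 * l) (tableau (3 * int (Suc l) - x, x)) = replicate 2 1 @ replicate 1 2"
      by (simp only: tableau_def fst_conv snd_conv replicate_add append_assoc) (simp add: 2)
    with 2 show ?thesis
      by (simp add: triple_elt_def string_elt_def numeral_eq_Suc)
  next
    case 3
    then have "nat (3 * int (Suc l) - x) = 3 * l + 1" by simp
    then have "drop (3 * l) (tableau (3 * int (Suc l) - x, x)) = replicate 1 1 @ replicate 2 2"
      by (simp only: tableau_def fst_conv snd_conv replicate_add append_assoc) (simp add: 3)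
    with 3 show ?thesis
      by (simp add: triple_elt_def string_elt_def numeral_eq_Suc)
  next
    case 4
    \<comment> \<open>All ones lie in the dropped prefix, so three twos survive.\<close>
    then have "3 * l - nat (3 * int (Suc l) - x) = nat x - 3"
      "nat (3 * int (Suc l) - x) \<le> 3 * l"
      "nat x - (nat x - 3) = 3"
      using assms by (auto simp: nat_diff_distrib)
    then show ?thesis using 4
      by (simp add: tableau_def triple_elt_def string_elt_def numeral_3_eq_3)
  qed
qed

lemma i_word_Suc:
  assumes "0 \<le> x" "x \<le> 3 * int (Suc l)"
  shows "i_word (Suc l) x = string_elt (min x 3) # i_word l (x - min x 3)"
proof -
  define t where "t = tableau (3 * int (Suc l) - x, x)"
  have len: "length t = 3 * Suc l"
    using assms by (simp add: t_def tableau_def)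
  have take_t: "take (3 * l) t = tableau (3 * int l - (x - min x 3), x - min x 3)"
  proof -
    have "min (3 * int (Suc l) - x) (int (3 * l)) = 3 * int l - (x - min x 3)"
      "min x (max 0 (int (3 * l) - (3 * int (Suc l) - x))) = x - min x 3"
      using assms by auto
    then show ?thesis
      unfolding t_def using assms by (subst take_tableau) simp_all
  qed
  have "take 3 (drop (3 * l) t) = drop (3 * l) t"
    using len by simp
  then have first: "b_seq (3 * int (Suc l) - x, x) (Suc l) = string_elt (min x 3)"
    using triple_elt_drop_tableau[OF assms] by (simp add: b_seq_def t_def)
  have rest: "b_seq (3 * int (Suc l) - x, x) k
      = b_seq (3 * int l - (x - min x 3), x - min x 3) k" if "1 \<le> k" "k \<le> l" for k
  proof -
    \<comment> \<open>Triple \<open>k\<close> lies entirely within the first \<open>3 * l\<close>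
      letters, so truncation leaves it intact.\<close>
    have "min 3 (3 * l - 3 * (k - 1)) = 3"
      using that by linarith
    then have "take 3 (drop (3 * (k - 1)) (take (3 * l) t)) = take 3 (drop (3 * (k - 1)) t)"
      by (simp add: drop_take)
    then show ?thesis
      by (simp only: b_seq_def take_t flip: t_def)
  qed
  have "map (b_seq (3 * int (Suc l) - x, x)) (rev [1..<Suc l])
      = map (b_seq (3 * int l - (x - min x 3), x - min x 3)) (rev [1..<Suc l])"
    using rest by (intro map_cong) auto
  with first show ?thesis
    by (simp add: i_word_def i_map_def)
qed

lemma i_word_in_tensor_power:
  assumes "is_B1 C" "0 \<le> x" "x \<le> 3 * int l"
  shows "i_word l x \<in> tensor_power C l"
  using assms(2,3)
proof (induction l arbitrary: x)
  case 0
  then show ?case by (simp add: i_word_def i_map_def tensor_power_def)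
next
  case (Suc l)
  have "i_word l (x - min x 3) \<in> tensor_power C l"
    using Suc.prems by (intro Suc.IH) auto
  then show ?case
    using string_elt_carr[OF assms(1)] i_word_Suc[OF Suc.prems]
    by (simp add: tensor_power_def)
qed

text \<open>The value of \<open>ten_eps\<close> is carried through the induction because it decides
  on which factor the operators act.\<close>

lemma ten_i_word:
  assumes "is_B1 C" "0 \<le> x" "x \<le> 3 * int l"
  shows "ten_eps C (i_word l x) = x \<and>
    ten_e C (i_word l x) = (if x = 0 then None else Some (i_word l (x - 1))) \<and>
    ten_f C (i_word l x) = (if x = 3 * int l then None else Some (i_word l (x + 1)))"
  using assms(2,3)
proof (induction l arbitrary: x)
  case 0
  \<comment> \<open>Here \<open>x = 0\<close>, and the default values at the empty word fit the
    claim.\<close>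
  then show ?case by (simp add: i_word_def i_map_def)
next
  case (Suc l)
  define j where "j = min x 3"
  have j: "0 \<le> j" "j \<le> 3" using Suc.prems by (auto simp: j_def)
  have word: "i_word (Suc l) x = string_elt j # i_word l (x - j)"
    using i_word_Suc[OF Suc.prems] by (simp add: j_def)
  have IH: "ten_eps C (i_word l (x - j)) = x - j"
    "ten_e C (i_word l (x - j)) = (if x = j then None else Some (i_word l (x - j - 1)))"
    "ten_f C (i_word l (x - j)) = (if x - j = 3 * int l then None else Some (i_word l (x - j + 1)))"
    using Suc.IH[of "x - j"] Suc.prems by (auto simp: j_def)
  have "0 \<le> ten_eps C (i_word l (x - j))"
    unfolding IH by (simp add: j_def)
  note ten = ten_Cons_string_elt[OF assms(1) j this, folded word, unfolded IH]
  have eps: "ten_eps C (i_word (Suc l) x) = x"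
    using ten(1) Suc.prems by (auto simp: j_def)
  have e: "ten_e C (i_word (Suc l) x) = (if x = 0 then None else Some (i_word (Suc l) (x - 1)))"
  proof (cases "x = 0")
    case False
    then have "i_word (Suc l) (x - 1) = string_elt (min (x - 1) 3) # i_word l (x - 1 - min (x - 1) 3)"
      using Suc.prems by (intro i_word_Suc) linarith+
    then show ?thesis using ten(2) Suc.prems False
      \<comment> \<open>At \<open>x = 4\<close>, \<open>min (x - 1) 3\<close> unfolds to
        \<open>x - 1\<close>, which is still 3, so the leftmost factor is unchanged.\<close>
      by (cases "x \<le> 3"; cases "x = 4") (auto simp: j_def min_def)
  qed (use ten(2) in \<open>simp add: j_def\<close>)
  have f: "ten_f C (i_word (Suc l) x)
      = (if x = 3 * int (Suc l) then None else Some (i_word (Suc l) (x + 1)))"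
  proof (cases "x = 3 * int (Suc l)")
    case False
    then have "i_word (Suc l) (x + 1) = string_elt (min (x + 1) 3) # i_word l (x + 1 - min (x + 1) 3)"
      using Suc.prems by (intro i_word_Suc) linarith+
    then show ?thesis using ten(3) Suc.prems False
      by (cases "x < 3") (auto simp: j_def min_def algebra_simps)
  qed (use ten(3) in \<open>simp add: j_def\<close>)
  from eps e f show ?case by blast
qed

theorem proposition10:
  fixes l :: nat and B1 :: "coords crystal2"
  assumes "l \<ge> 1" and "is_B1 B1"
  shows "i_map l \<in> tilde_B (3 * l) \<rightarrow> tensor_power B1 l \<and>
    (\<forall>b \<in> tilde_B (3 * l).
       map_option (i_map l) (e1A b) = ten_e B1 (i_map l b) \<and>
       map_option (i_map l) (f1A b) = ten_f B1 (i_map l b))"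
proof -
  have main: "i_map l b \<in> tensor_power B1 l \<and>
      map_option (i_map l) (e1A b) = ten_e B1 (i_map l b) \<and>
      map_option (i_map l) (f1A b) = ten_f B1 (i_map l b)"
    if b: "b \<in> tilde_B (3 * l)" for b
  proof -
    obtain x where x: "b = (3 * int l - x, x)" "0 \<le> x" "x \<le> 3 * int l"
      using b by (auto simp: tilde_B_def algebra_simps)
    have "e1A b = (if x = 0 then None else Some (3 * int l - (x - 1), x - 1))"
      "f1A b = (if x = 3 * int l then None else Some (3 * int l - (x + 1), x + 1))"
      using x by (auto simp: e1A_def f1A_def nonneg_or_zero_def)
    then show ?thesis
      using ten_i_word[OF assms(2) x(2,3)] i_word_in_tensor_power[OF assms(2) x(2,3)]
      by (simp add: i_word_def x(1))
  qed
  then show ?thesis by blast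
qed

end
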